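(* Let $\theta$ be such that the cross-sections $\mathcal S_0=\{0\},\mathcal S_1,\dots,\mathcal S_H$ of $\mathcal E_\theta$ are shift-compatible, i.e. $A_K^j\mathcal S_1\oplus\mathcal S_j\subseteq\mathcal S_{j+1}$ for $j=0,\dots,H-1$, and suppose the terminal ingredients assumption (see context) holds. If the CT-MPC problem is feasible at time $k$ (i.e. at state $x_k$), with optimal solution $(z^\star_{t\mid k}),(v^\star_{t\mid k})$, the input $u_k=v^\star_{0\mid k}$ is applied, and the realized one-step prediction error satisfies $$e_{1\mid k}:=x_{k+1}-z^\star_{1\mid k}\in\mathcal S_1,$$ then the CT-MPC problem is feasible at time $k+1$ (i.e. at state $x_{k+1}$). If, in addition, the calibrated parameter $\theta=\hat\theta_N$ satisfies $\mathbb P^N\{V_N\le\varepsilon_{N,s}(\beta)\}\ge1-\beta$, then with probability at least $1-\beta$ over the calibration data $S_N$, $$\mathbb P\{\text{CT-MPC is infeasible at }k+1\mid\text{CT-MPC is feasible at }k,\ S_N\}\le\varepsilon_{N,s}(\beta).$$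
   Context: System: $x_{k+1}=Ax_k+Bu_k+w_k$, $x_k\in\mathbb R^n$, $u_k\in\mathbb R^m$, $w_k$ random disturbance. $\mathcal X\subset\mathbb R^n$, $\mathcal U\subset\mathbb R^m$ are compact convex constraint sets with the origin in their interiors. $K$ is a fixed gain, $A_K:=A+BK$ (stable). With nominal dynamics $z_{t+1}=Az_t+Bv_t$, actual prediction $x_t=z_t+e_t$ and feedback $u_t=v_t+Ke_t$, the prediction error satisfies $e_{t+1}=A_Ke_t+w_t$, with $e_0=0$ at each MPC epoch (measured-state initialization $z_0=x_k$). Tube: $\mathcal E_\theta\subseteq\mathbb R^{nH}$, $\theta\in\Theta$, measurable. Cross-sections: $\mathcal S_0=\{0\}$, and for $t=1,\dots,H$, $\mathcal S_t=\mathcal S_t(\theta)$ is the projection $\{e_t:\exists(e_1,\dots,e_H)\in\mathcal E_\theta\}$ of $\mathcal E_\theta$ onto its $t$-th block, taken compact and convex (or, if needed, replaced by a compact convex set containing that projection). $\oplus$ is Minkowski sum and $P\ominus Q:=\{a:a+Q\subseteq P\}$. CT-MPC problem at state $x$: minimize $\ell_f(z_H)+\sum_{t=0}^{H-1}\ell(z_t,v_t)$ over $(z_0,\dots,z_H)$, $(v_0,\dots,v_{H-1})$ subject to $z_0=x$; $z_{t+1}=Az_t+Bv_t$, $z_t\in\mathcal X\ominus\mathcal S_t$, $v_t\in\mathcal U\ominus K\mathcal S_t$ for $t=0,\dots,H-1$; and $z_H\in\mathcal X_f$, where $\mathcal X_f=\mathcal X_f(\theta)$. Terminal ingredients assumption: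 $\mathcal X_f$ is compact and convex and there is a gain $K_f$ such that, with $A_f:=A+BK_f$, (a) $\mathcal X_f\oplus\mathcal S_H\subseteq\mathcal X$; (b) $\mathcal X_f\oplus A_K^{H-1}\mathcal S_1\subseteq\mathcal X\ominus\mathcal S_{H-1}$; (c) $K_f(\mathcal X_f\oplus A_K^{H-1}\mathcal S_1)\subseteq\mathcal U\ominus K\mathcal S_{H-1}$; (d) $A_f(\mathcal X_f\oplus A_K^{H-1}\mathcal S_1)\subseteq\mathcal X_f$; and moreover $\ell_f(A_fz)-\ell_f(z)\le-\ell(z,K_fz)$ for all $z\in\mathcal X_f$. Sampling assumption: all modelling and tuning choices are fixed before the calibration residual trajectories $S_N=(\mathbf E^1,\dots,\mathbf E^N)$, $\mathbf E^i\in\mathbb R^{nH}$, are used; conditional on this training/tuning information and on the online information pattern (conditioning suppressed in the notation), $\mathbf E^1,\dots,\mathbf E^N$ and any finite number of fresh residual trajectories are i.i.d. The online error trajectory $\mathbf E_k=(e_{1\mid k},\dots,e_{H\mid k})$ at update $k$ is such a fresh trajectory (so, given $S_N$ and the information at time $k$, in particular feasibility at $k$, its probability of leaving $\mathcal E_{\hat\theta_N}$ is $V_N$). $\hat\theta_N$ is the tube parameter computed from $S_N$, $V_N:=\mathbb P\{\mathbf E\notin\mathcal E_{\hat\theta_N}\mid S_N\}$ with $\mathbf E$ fresh, $\mathbb P^N$ is the law of $S_N$, $\beta\in(0,1)$, $s\in\{1,\dots,N\}$, $B_{N,s}(\varepsilon):=\sum_{j=0}^{s-1}\binom Nj\varepsilon^j(1-\varepsilon)^{N-j}$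 and $\varepsilon_{N,s}(\beta):=\inf\{\varepsilon\in[0,1]:B_{N,s}(\varepsilon)\le\beta\}$. *)

theory Defs
  imports "HOL-Probability.Probability"
begin

text \<open>Minkowski sums are the library's \<^term>\<open>P + Q\<close> on sets
  (\<^theory>\<open>HOL-Library.Set_Algebras\<close>), whereas \<^term>\<open>P - Q\<close> on sets is the set difference.\<close>

definition pontryagin_diff :: "'a::plus set \<Rightarrow> 'a set \<Rightarrow> 'a set" (infixl \<open>\<ominus>\<^sub>P\<close> 65) where
  "P \<ominus>\<^sub>P Q = {a. {a} + Q \<subseteq> P}"

text \<open>The instance \<^term>\<open>(^)\<close> on square matrices is componentwise, hence a separate matrix power.\<close>

primrec mat_pow :: "real^'n^'n \<Rightarrow> nat \<Rightarrow> real^'n^'n" where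
  "mat_pow M 0 = mat 1"
| "mat_pow M (Suc j) = M ** mat_pow M j"

definition schur_stable :: "real^'n^'n \<Rightarrow> bool" where
  "schur_stable M \<longleftrightarrow>
     (\<forall>(c::complex) v. v \<noteq> 0 \<and> map_matrix complex_of_real M *v v = c *s v \<longrightarrow> cmod c < 1)"

text \<open>The space of error trajectories \<open>(e\<^sub>1, \<dots>, e\<^sub>H)\<close>, i.e. \<open>R\<^sup>n\<^sup>H\<close> with its Borel sets.
  Its elements are functions on \<open>nat\<close> that are \<^term>\<open>undefined\<close> outside \<^term>\<open>{1..H}\<close>.\<close>

abbreviation traj_space :: "nat \<Rightarrow> (nat \<Rightarrow> real^'n) measure" where
  "traj_space H \<equiv> PiM {1..H} (\<lambda>_. borel)"

abbreviation sample_space :: "nat \<Rightarrow> nat \<Rightarrow> (nat \<Rightarrow> nat \<Rightarrow> real^'n) measure" where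
  "sample_space N H \<equiv> PiM {1..N} (\<lambda>_. traj_space H)"

primrec pred_error :: "real^'n^'n \<Rightarrow> (nat \<Rightarrow> real^'n) \<Rightarrow> nat \<Rightarrow> real^'n" where
  "pred_error AK d 0 = 0"
| "pred_error AK d (Suc t) = AK *v pred_error AK d t + d t"

definition error_traj :: "real^'n^'n \<Rightarrow> nat \<Rightarrow> (nat \<Rightarrow> real^'n) \<Rightarrow> nat \<Rightarrow> real^'n" where
  "error_traj AK H d = restrict (pred_error AK d) {1..H}"

text \<open>The inclusion admits both the exact projections of the tube and compact convex supersets
  of them.\<close>

definition cross_sections :: "nat \<Rightarrow> (nat \<Rightarrow> real^'n) set \<Rightarrow> (nat \<Rightarrow> (real^'n) set) \<Rightarrow> bool" where
  "cross_sections H E S \<longleftrightarrow>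
     S 0 = {0} \<and>
     (\<forall>t\<in>{1..H}. compact (S t) \<and> convex (S t) \<and> (\<lambda>e. e t) ` E \<subseteq> S t)"

definition shift_compatible :: "real^'n^'n \<Rightarrow> nat \<Rightarrow> (nat \<Rightarrow> (real^'n) set) \<Rightarrow> bool" where
  "shift_compatible AK H S \<longleftrightarrow>
     (\<forall>j<H. (*v) (mat_pow AK j) ` S 1 + S j \<subseteq> S (Suc j))"

definition terminal_ingredients ::
  "real^'n^'n \<Rightarrow> real^'m^'n \<Rightarrow> real^'n^'m \<Rightarrow> (real^'n) set \<Rightarrow> (real^'m) set \<Rightarrow> nat \<Rightarrow>
   (real^'n \<Rightarrow> real^'m \<Rightarrow> real) \<Rightarrow> (real^'n \<Rightarrow> real) \<Rightarrow>
   (nat \<Rightarrow> (real^'n) set) \<Rightarrow> (real^'n) set \<Rightarrow> bool" where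
  "terminal_ingredients A B K X U H l lf S Xf \<longleftrightarrow>
     compact Xf \<and> convex Xf \<and>
     (\<exists>Kf :: real^'n^'m.
        let Af = A + B ** Kf; D = Xf + (*v) (mat_pow (A + B ** K) (H - 1)) ` S 1 in
        Xf + S H \<subseteq> X \<and>
        D \<subseteq> X \<ominus>\<^sub>P S (H - 1) \<and>
        (*v) Kf ` D \<subseteq> U \<ominus>\<^sub>P (*v) K ` S (H - 1) \<and>
        (*v) Af ` D \<subseteq> Xf \<and>
        (\<forall>z\<in>Xf. lf (Af *v z) - lf z \<le> - l z (Kf *v z)))"

text \<open>Decision variables are functions on \<open>nat\<close>, of which only \<open>z\<^sub>0, \<dots>, z\<^sub>H\<close> and
  \<open>v\<^sub>0, \<dots>, v\<^sub>H\<^sub>-\<^sub>1\<close> enter.\<close>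

definition ctmpc_admissible ::
  "real^'n^'n \<Rightarrow> real^'m^'n \<Rightarrow> real^'n^'m \<Rightarrow> (real^'n) set \<Rightarrow> (real^'m) set \<Rightarrow> nat \<Rightarrow>
   (nat \<Rightarrow> (real^'n) set) \<Rightarrow> (real^'n) set \<Rightarrow>
   real^'n \<Rightarrow> (nat \<Rightarrow> real^'n) \<Rightarrow> (nat \<Rightarrow> real^'m) \<Rightarrow> bool" where
  "ctmpc_admissible A B K X U H S Xf x z v \<longleftrightarrow>
     z 0 = x \<and>
     (\<forall>t<H. z (Suc t) = A *v z t + B *v v t \<and>
            z t \<in> X \<ominus>\<^sub>P S t \<and>
            v t \<in> U \<ominus>\<^sub>P (*v) K ` S t) \<and>
     z H \<in> Xf"

definition ctmpc_feasible ::
  "real^'n^'n \<Rightarrow> real^'m^'n \<Rightarrow> real^'n^'m \<Rightarrow> (real^'n) set \<Rightarrow> (real^'m) set \<Rightarrow> nat \<Rightarrow>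
   (nat \<Rightarrow> (real^'n) set) \<Rightarrow> (real^'n) set \<Rightarrow> real^'n \<Rightarrow> bool" where
  "ctmpc_feasible A B K X U H S Xf x \<longleftrightarrow> (\<exists>z v. ctmpc_admissible A B K X U H S Xf x z v)"

definition ctmpc_cost ::
  "nat \<Rightarrow> ('a \<Rightarrow> 'b \<Rightarrow> real) \<Rightarrow> ('a \<Rightarrow> real) \<Rightarrow> (nat \<Rightarrow> 'a) \<Rightarrow> (nat \<Rightarrow> 'b) \<Rightarrow> real" where
  "ctmpc_cost H l lf z v = lf (z H) + (\<Sum>t<H. l (z t) (v t))"

definition ctmpc_optimal ::
  "real^'n^'n \<Rightarrow> real^'m^'n \<Rightarrow> real^'n^'m \<Rightarrow> (real^'n) set \<Rightarrow> (real^'m) set \<Rightarrow> nat \<Rightarrow>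
   (real^'n \<Rightarrow> real^'m \<Rightarrow> real) \<Rightarrow> (real^'n \<Rightarrow> real) \<Rightarrow>
   (nat \<Rightarrow> (real^'n) set) \<Rightarrow> (real^'n) set \<Rightarrow>
   real^'n \<Rightarrow> (nat \<Rightarrow> real^'n) \<Rightarrow> (nat \<Rightarrow> real^'m) \<Rightarrow> bool" where
  "ctmpc_optimal A B K X U H l lf S Xf x z v \<longleftrightarrow>
     ctmpc_admissible A B K X U H S Xf x z v \<and>
     (\<forall>z' v'. ctmpc_admissible A B K X U H S Xf x z' v' \<longrightarrow>
        ctmpc_cost H l lf z v \<le> ctmpc_cost H l lf z' v')"

definition binom_tail :: "nat \<Rightarrow> nat \<Rightarrow> real \<Rightarrow> real" where
  "binom_tail N s \<epsilon> = (\<Sum>j<s. real (N choose j) * \<epsilon> ^ j * (1 - \<epsilon>) ^ (N - j))"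

definition risk_level :: "nat \<Rightarrow> nat \<Rightarrow> real \<Rightarrow> real" where
  "risk_level N s \<beta> = Inf {\<epsilon>\<in>{0..1}. binom_tail N s \<epsilon> \<le> \<beta>}"

definition calib_data :: "nat \<Rightarrow> (nat \<Rightarrow> 'w \<Rightarrow> nat \<Rightarrow> real^'n) \<Rightarrow> 'w \<Rightarrow> nat \<Rightarrow> nat \<Rightarrow> real^'n" where
  "calib_data N R \<omega> = (\<lambda>i\<in>{1..N}. R i \<omega>)"

abbreviation calib_sigma ::
  "'w measure \<Rightarrow> nat \<Rightarrow> nat \<Rightarrow> (nat \<Rightarrow> 'w \<Rightarrow> nat \<Rightarrow> real^'n) \<Rightarrow> 'w measure" where
  "calib_sigma M N H R \<equiv> vimage_algebra (space M) (calib_data N R) (sample_space N H)"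

text \<open>Conditional probability of the event \<open>P\<close> given the sub-sigma-algebra \<open>G\<close>, and of \<open>P\<close>
  given both the event \<open>Q\<close> and \<open>G\<close>. The quotient is \<open>0\<close> where \<open>Q\<close> has conditional
  probability \<open>0\<close>, i.e. where conditioning on \<open>Q\<close> is void.\<close>

definition sigma_prob :: "'w measure \<Rightarrow> 'w measure \<Rightarrow> ('w \<Rightarrow> bool) \<Rightarrow> 'w \<Rightarrow> real" where
  "sigma_prob M G P = real_cond_exp M G (indicator {\<omega>\<in>space M. P \<omega>})"

definition sigma_cond_prob ::
  "'w measure \<Rightarrow> 'w measure \<Rightarrow> ('w \<Rightarrow> bool) \<Rightarrow> ('w \<Rightarrow> bool) \<Rightarrow> 'w \<Rightarrow> real" where
  "sigma_cond_prob M G P Q \<omega> =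
     sigma_prob M G (\<lambda>\<omega>. P \<omega> \<and> Q \<omega>) \<omega> / sigma_prob M G Q \<omega>"

text \<open>\<open>R 1, \<dots>, R N\<close> are the calibration trajectories and \<open>R (N + 1)\<close> is the fresh one that enters
  \<open>V\<^sub>N\<close>. The online trajectory \<open>F\<close> has the same law and is independent of the online information
  \<open>I\<close>, a sigma-algebra that contains the calibration data. Conditioning on the training and tuning
  information is part of the probability measure \<open>M\<close>.\<close>

definition fresh_sampling ::
  "'w measure \<Rightarrow> nat \<Rightarrow> nat \<Rightarrow> (nat \<Rightarrow> 'w \<Rightarrow> nat \<Rightarrow> real^'n) \<Rightarrow>
   'w measure \<Rightarrow> ('w \<Rightarrow> nat \<Rightarrow> real^'n) \<Rightarrow> bool" where
  "fresh_sampling M N H R I F \<longleftrightarrow>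
     prob_space M \<and>
     prob_space.indep_vars M (\<lambda>_. traj_space H) R {1..N+1} \<and>
     (\<forall>i\<in>{1..N+1}. distr M (traj_space H) (R i) = distr M (traj_space H) (R 1)) \<and>
     subalgebra M I \<and>
     calib_data N R \<in> measurable I (sample_space N H) \<and>
     F \<in> measurable M (traj_space H) \<and>
     distr M (traj_space H) F = distr M (traj_space H) (R 1) \<and>
     prob_space.indep_set M (sets (vimage_algebra (space M) F (traj_space H))) (sets I)"

definition tube_violation ::
  "'w measure \<Rightarrow> nat \<Rightarrow> nat \<Rightarrow> (nat \<Rightarrow> 'w \<Rightarrow> nat \<Rightarrow> real^'n) \<Rightarrow>
   ('t \<Rightarrow> (nat \<Rightarrow> real^'n) set) \<Rightarrow> ((nat \<Rightarrow> nat \<Rightarrow> real^'n) \<Rightarrow> 't) \<Rightarrow> 'w \<Rightarrow> real" where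
  "tube_violation M N H R E th =
     sigma_prob M (calib_sigma M N H R) (\<lambda>\<omega>. R (N + 1) \<omega> \<notin> E (th (calib_data N R \<omega>)))"

end

theory Submission
  imports Defs
begin

text \<open>Shifting the old plan by one step and adding \<open>A\<^sub>K\<^sup>t e\<close> to it, with \<open>e\<close> the realized error,
  stays inside the tightened constraints because \<open>A\<^sub>K\<^sup>t e + S\<^sub>t \<subseteq> S\<^sub>t\<^sub>+\<^sub>1\<close>; the terminal gain
  supplies the last input. So infeasibility after feasibility forces the online error trajectory out of
  the tube. As that trajectory is independent of the online information, the conditional
  probability of this exit is almost surely \<open>V\<^sub>N\<close>, whether or not one also conditions on
  feasibility.\<close>


section \<open>Feasibility of the shifted plan\<close>

lemma pontryagin_diff_shift:
  fixes P :: "'a::ab_semigroup_add set"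
  assumes "a \<in> P \<ominus>\<^sub>P Q'" and "\<And>q. q \<in> Q \<Longrightarrow> b + q \<in> Q'"
  shows "a + b \<in> P \<ominus>\<^sub>P Q"
  using assms unfolding pontryagin_diff_def set_plus_def by (fastforce simp: add.assoc)

text \<open>Used pathwise for the deterministic claim, and at almost every sample point where the
  tube holds the online error for the probabilistic one.\<close>

lemma ctmpc_feasible_shift:
  fixes A :: "real^'n^'n" and B :: "real^'m^'n" and K :: "real^'n^'m"
  assumes H: "H \<ge> 1"
    and shift: "shift_compatible (A + B ** K) H S"
    and ti: "terminal_ingredients A B K X U H l lf S Xf"
    and adm: "ctmpc_admissible A B K X U H S Xf x z v"
    and e: "x' - z 1 \<in> S 1"
  shows "ctmpc_feasible A B K X U H S Xf x'"
proof -
  define AK where "AK = A + B ** K"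
  define e where "e = x' - z 1"
  \<comment> \<open>Response of the closed-loop error dynamics to the initial error
    \<open>e\<close>. It also solves the nominal dynamics with input \<open>K *v p t\<close>, so it
    can be added to a nominal plan.\<close>
  define p where "p t = mat_pow AK t *v e" for t
  have p_Suc: "p (Suc t) = A *v p t + B *v (K *v p t)" for t
    by (simp add: p_def AK_def matrix_vector_mult_add_rdistrib flip: matrix_vector_mul_assoc)
  have p_shift: "p t + q \<in> S (Suc t)" if "t < H" "q \<in> S t" for t q
    using shift that e unfolding shift_compatible_def p_def e_def AK_def set_plus_def by blast
  obtain Kf :: "real^'n^'m" where Kf: 
    "Xf + (*v) (mat_pow AK (H - 1)) ` S 1 \<subseteq> X \<ominus>\<^sub>P S (H - 1)"
    "(*v) Kf ` (Xf + (*v) (mat_pow AK (H - 1)) ` S 1) \<subseteq> U \<ominus>\<^sub>P (*v) K ` S (H - 1)"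
    "(*v) (A + B ** Kf) ` (Xf + (*v) (mat_pow AK (H - 1)) ` S 1) \<subseteq> Xf"
    using ti unfolding terminal_ingredients_def Let_def AK_def by blast
  \<comment> \<open>Shifted state one step before the new horizon ends: a point of \<open>Xf\<close>
    moved by the error propagated \<open>H - 1\<close> times, which is exactly the enlargement of
    \<open>Xf\<close> in the terminal conditions.\<close>
  define y where "y = z H + p (H - 1)"
  have y: "y \<in> Xf + (*v) (mat_pow AK (H - 1)) ` S 1"
    using adm e unfolding y_def p_def e_def ctmpc_admissible_def by (intro set_plus_intro) auto
  \<comment> \<open>The two switches differ by one: \<open>z' (H - 1) = y\<close> still belongs to
    the shifted plan, but its input would be \<open>v H\<close>, which the old plan leaves
    unconstrained. So \<open>Kf\<close> takes over at \<open>H - 1\<close> and produces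
    \<open>z' H\<close>.\<close>
  define z' where "z' t = (if t < H then z (Suc t) + p t else (A + B ** Kf) *v y)" for t
  define v' where "v' t = (if Suc t < H then v (Suc t) + K *v p t else Kf *v y)" for t
  have "ctmpc_admissible A B K X U H S Xf x' z' v'"
    unfolding ctmpc_admissible_def
  proof (intro conjI allI impI)
    show "z' 0 = x'"
      using H by (simp add: z'_def p_def e_def)
    show "z' H \<in> Xf"
      using Kf(3) y by (auto simp: z'_def)
  next
    fix t assume t: "t < H"
    show "z' (Suc t) = A *v z' t + B *v v' t"
    proof (cases "Suc t < H")
      case True
      then have "z (Suc (Suc t)) = A *v z (Suc t) + B *v v (Suc t)"
        using adm by (simp add: ctmpc_admissible_def)
      with True t show ?thesis
        by (simp add: z'_def v'_def p_Suc matrix_vector_right_distrib)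
    next
      case False
      with t have "H = Suc t" by simp
      then show ?thesis
        by (simp add: z'_def v'_def y_def matrix_vector_mult_add_rdistrib matrix_vector_mul_assoc)
    qed
    show "z' t \<in> X \<ominus>\<^sub>P S t"
    proof (cases "Suc t < H")
      case True
      then have "z (Suc t) \<in> X \<ominus>\<^sub>P S (Suc t)"
        using adm unfolding ctmpc_admissible_def by blast
      \<comment> \<open>Passing from the tightening by \<open>S (Suc t)\<close> to that by
        \<open>S t\<close> frees the room that the displacement \<open>p t\<close> takes up.\<close>
      then have "z (Suc t) + p t \<in> X \<ominus>\<^sub>P S t"
        by (rule pontryagin_diff_shift) (rule p_shift[OF t])
      with t show ?thesis by (simp add: z'_def)
    next
      case False
      with t have "H = Suc t" by simp
      then show ?thesis
        using Kf(1) y by (auto simp: z'_def y_def)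
    qed
    show "v' t \<in> U \<ominus>\<^sub>P (*v) K ` S t"
    proof (cases "Suc t < H")
      case True
      have "v (Suc t) + K *v p t \<in> U \<ominus>\<^sub>P (*v) K ` S t"
      proof (rule pontryagin_diff_shift)
        show "v (Suc t) \<in> U \<ominus>\<^sub>P (*v) K ` S (Suc t)"
          using adm True by (auto simp: ctmpc_admissible_def)
        show "K *v p t + q \<in> (*v) K ` S (Suc t)" if "q \<in> (*v) K ` S t" for q
          using that p_shift[OF t] by (auto simp flip: matrix_vector_right_distrib)
      qed
      with True show ?thesis by (simp add: v'_def)
    next
      case False
      with t have "H = Suc t" by simp
      then show ?thesis
        using Kf(2) y by (auto simp: v'_def)
    qed
  qed
  then show ?thesis
    unfolding ctmpc_feasible_def by blast
qed


section \<open>Freezing an independent variable in conditional probabilities\<close>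

lemma (in prob_space) sigma_finite_subalgebraI:
  assumes "subalgebra M G"
  shows "sigma_finite_subalgebra M G"
proof -
  interpret finite_measure_subalgebra M G
    by unfold_locales (rule assms)
  show ?thesis
    by (rule finite_measure_subalgebra_is_sigma_finite) unfold_locales
qed

text \<open>The identity, read as a random element with values in \<open>G\<close>, carries all
  information of \<open>G\<close>, so independence becomes a product law, which can be integrated
  section by section. Agreement on rectangles suffices because both marginals are finite.\<close>

lemma (in prob_space) indep_set_vimage_distr_Pair:
  assumes sub: "subalgebra M G" and F[measurable]: "F \<in> measurable M T"
    and ind: "indep_set (sets (vimage_algebra (space M) F T)) (sets G)"
  shows "distr M (G \<Otimes>\<^sub>M T) (\<lambda>\<omega>. (\<omega>, F \<omega>)) = distr M G (\<lambda>\<omega>. \<omega>) \<Otimes>\<^sub>M distr M T F"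
proof -
  have sp: "space G = space M"
    using sub by (simp add: subalgebra_def)
  have id[measurable]: "(\<lambda>\<omega>. \<omega>) \<in> measurable M G"
    using measurable_from_subalg[OF sub measurable_ident_sets[OF refl, of G]] by simp
  have "distr M G (\<lambda>\<omega>. \<omega>) \<Otimes>\<^sub>M distr M T F = distr M (G \<Otimes>\<^sub>M T) (\<lambda>\<omega>. (\<omega>, F \<omega>))"
  proof (rule pair_measure_eqI)
    fix A B assume "A \<in> sets (distr M G (\<lambda>\<omega>. \<omega>))" "B \<in> sets (distr M T F)"
    then have A[measurable]: "A \<in> sets G" and B[measurable]: "B \<in> sets T" by auto
    have "F -` B \<inter> space M \<in> sets (vimage_algebra (space M) F T)"
      by (rule in_vimage_algebra[OF B])
    then have eq: "prob ((F -` B \<inter> space M) \<inter> A) = prob (F -` B \<inter> space M) * prob A"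
      using ind A unfolding indep_sets2_eq by blast
    have A_space: "A \<subseteq> space M"
      using sets.sets_into_space[OF A] by (simp add: sp)
    have "emeasure (distr M (G \<Otimes>\<^sub>M T) (\<lambda>\<omega>. (\<omega>, F \<omega>))) (A \<times> B) =
        prob ((\<lambda>\<omega>. (\<omega>, F \<omega>)) -` (A \<times> B) \<inter> space M)"
      by (subst emeasure_distr) (auto simp: emeasure_eq_measure)
    also have "(\<lambda>\<omega>. (\<omega>, F \<omega>)) -` (A \<times> B) \<inter> space M = (F -` B \<inter> space M) \<inter> A"
      by auto
    finally show "emeasure (distr M G (\<lambda>\<omega>. \<omega>)) A * emeasure (distr M T F) B =
        emeasure (distr M (G \<Otimes>\<^sub>M T) (\<lambda>\<omega>. (\<omega>, F \<omega>))) (A \<times> B)"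
      using A_space
      by (simp add: emeasure_distr emeasure_eq_measure eq Int_absorb2 mult.commute flip: ennreal_mult)
  next
    show "sigma_finite_measure (distr M G (\<lambda>\<omega>. \<omega>))" "sigma_finite_measure (distr M T F)"
      by (intro finite_measure.sigma_finite_measure prob_space.finite_measure prob_space_distr; measurable)+
  qed (simp cong: sets_pair_measure_cong)
  then show ?thesis ..
qed

text \<open>Freezing lemma: conditionally on \<open>G\<close>, an independent \<open>F\<close> is integrated out against its law
  while the \<open>G\<close>-measurable coordinate stays fixed.\<close>

lemma (in prob_space) sigma_prob_freeze:
  assumes sub: "subalgebra M G" and F[measurable]: "F \<in> measurable M T"
    and ind: "indep_set (sets (vimage_algebra (space M) F T)) (sets G)"
    and Q[measurable]: "Q \<in> sets (G \<Otimes>\<^sub>M T)"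
  shows "AE \<omega> in M. sigma_prob M G (\<lambda>\<omega>. (\<omega>, F \<omega>) \<in> Q) \<omega> =
           measure (distr M T F) (Pair \<omega> -` Q)"
proof -
  interpret sigma_finite_subalgebra M G
    by (rule sigma_finite_subalgebraI[OF sub])
  interpret \<mu>: prob_space "distr M T F"
    by (rule prob_space_distr) measurable
  have sp: "space G = space M"
    using sub by (simp add: subalgebra_def)
  have id[measurable]: "(\<lambda>\<omega>. \<omega>) \<in> measurable M G"
    using measurable_from_subalg[OF sub measurable_ident_sets[OF refl, of G]] by simp
  \<comment> \<open>Candidate for the conditional probability. Once it is known to be
    \<open>G\<close>-measurable and integrable, it remains to compare integrals over sets of
    \<open>G\<close>.\<close>
  define g where "g \<omega> = measure (distr M T F) (Pair \<omega> -` Q)" for \<omega>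
  have g[measurable]: "g \<in> borel_measurable G"
  proof -
    have "Q \<in> sets (G \<Otimes>\<^sub>M distr M T F)"
      using Q by (simp cong: sets_pair_measure_cong)
    from \<mu>.measurable_emeasure_Pair[OF this] show ?thesis
      unfolding g_def measure_def by measurable
  qed
  have gM[measurable]: "g \<in> borel_measurable M"
    using measurable_from_subalg[OF sub g] .
  have int_g: "integrable M g"
    by (rule integrable_const_bound[where B=1]) (auto simp: g_def \<mu>.prob_le_1)
  have QM[measurable]: "{\<omega>\<in>space M. (\<omega>, F \<omega>) \<in> Q} \<in> sets M"
    by measurable
  have "AE \<omega> in M. real_cond_exp M G (indicator {\<omega>\<in>space M. (\<omega>, F \<omega>) \<in> Q}) \<omega> = g \<omega>"
  proof (rule real_cond_exp_charact)
    fix C assume C[measurable]: "C \<in> sets G"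
    have CM[measurable]: "C \<in> sets M"
      using C sub by (auto simp: subalgebra_def)
    \<comment> \<open>Building the test set \<open>C\<close> into the event turns the integral over
      \<open>C\<close> into a plain probability.\<close>
    define Q' where "Q' = Q \<inter> (C \<times> space T)"
    have Q'[measurable]: "Q' \<in> sets (G \<Otimes>\<^sub>M T)"
      unfolding Q'_def by measurable
    have "(\<integral>\<omega>\<in>C. indicator {\<omega>\<in>space M. (\<omega>, F \<omega>) \<in> Q} \<omega> \<partial>M) =
        measure M {\<omega>\<in>space M. (\<omega>, F \<omega>) \<in> Q'}"
    proof -
      have "(\<integral>\<omega>\<in>C. indicator {\<omega>\<in>space M. (\<omega>, F \<omega>) \<in> Q} \<omega> \<partial>M) =
          (\<integral>\<omega>. indicator {\<omega>\<in>space M. (\<omega>, F \<omega>) \<in> Q'} \<omega> \<partial>M)"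
        unfolding set_lebesgue_integral_def
        using measurable_space[OF F]
        by (intro Bochner_Integration.integral_cong) (auto simp: Q'_def indicator_def)
      also have "\<dots> = measure M {\<omega>\<in>space M. (\<omega>, F \<omega>) \<in> Q'}"
        by (simp add: Int_absorb2)
      finally show ?thesis .
    qed
    \<comment> \<open>Carried out in \<open>ennreal\<close>, where measures of sections integrate
      without integrability conditions; nonnegativity brings the identity back to the reals.\<close>
    moreover have "ennreal (measure M {\<omega>\<in>space M. (\<omega>, F \<omega>) \<in> Q'}) =
        ennreal (\<integral>\<omega>\<in>C. g \<omega> \<partial>M)"
    proof -
      have "ennreal (measure M {\<omega>\<in>space M. (\<omega>, F \<omega>) \<in> Q'}) =
          emeasure (distr M (G \<Otimes>\<^sub>M T) (\<lambda>\<omega>. (\<omega>, F \<omega>))) Q'"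
        by (subst emeasure_distr)
          (auto simp: emeasure_eq_measure intro!: arg_cong[where f=prob])
      also have "\<dots> = (\<integral>\<^sup>+\<omega>. emeasure (distr M T F) (Pair \<omega> -` Q') \<partial>distr M G (\<lambda>\<omega>. \<omega>))"
        unfolding indep_set_vimage_distr_Pair[OF sub F ind]
        by (rule \<mu>.emeasure_pair_measure_alt) (use Q' in \<open>simp cong: sets_pair_measure_cong\<close>)
      also have "\<dots> = (\<integral>\<^sup>+\<omega>. emeasure (distr M T F) (Pair \<omega> -` Q') \<partial>M)"
      proof (rule nn_integral_distr[OF id])
        have "Q' \<in> sets (G \<Otimes>\<^sub>M distr M T F)"
          using Q' by (simp cong: sets_pair_measure_cong)
        from \<mu>.measurable_emeasure_Pair[OF this]
        show "(\<lambda>\<omega>. emeasure (distr M T F) (Pair \<omega> -` Q')) \<in> borel_measurable (distr M G (\<lambda>\<omega>. \<omega>))"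
          by simp
      qed
      also have "\<dots> = (\<integral>\<^sup>+\<omega>. ennreal (indicator C \<omega> * g \<omega>) \<partial>M)"
      proof (rule nn_integral_cong)
        fix \<omega> assume "\<omega> \<in> space M"
        \<comment> \<open>Sections of \<open>Q\<close> already lie in \<open>space T\<close>, so
          cutting \<open>Q\<close> with \<open>C \<times> space T\<close> either keeps or empties
          them.\<close>
        have "Pair \<omega> -` Q' = (if \<omega> \<in> C then Pair \<omega> -` Q else {})"
          using sets.sets_into_space[OF Q] by (auto simp: Q'_def space_pair_measure)
        then show "emeasure (distr M T F) (Pair \<omega> -` Q') = ennreal (indicator C \<omega> * g \<omega>)"
          by (simp add: g_def \<mu>.emeasure_eq_measure)
      qed
      also have "\<dots> = ennreal (\<integral>\<omega>\<in>C. g \<omega> \<partial>M)"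
        unfolding set_lebesgue_integral_def real_scaleR_def
        by (rule nn_integral_eq_integral)
          (use integrable_mult_indicator[OF CM int_g] in \<open>auto simp: g_def\<close>)
      finally show ?thesis .
    qed
    moreover have "(\<integral>\<omega>\<in>C. g \<omega> \<partial>M) \<ge> 0"
      unfolding set_lebesgue_integral_def by (intro Bochner_Integration.integral_nonneg) (simp add: g_def)
    ultimately show "(\<integral>\<omega>\<in>C. indicator {\<omega>\<in>space M. (\<omega>, F \<omega>) \<in> Q} \<omega> \<partial>M) = (\<integral>\<omega>\<in>C. g \<omega> \<partial>M)"
      by simp
  qed (use int_g in \<open>auto simp: emeasure_eq_measure\<close>)
  then show ?thesis
    by (simp add: sigma_prob_def g_def)
qed

lemma (in prob_space) sigma_prob_mono:
  assumes sub: "subalgebra M G"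
    and "{\<omega>\<in>space M. P \<omega>} \<in> sets M" "{\<omega>\<in>space M. P' \<omega>} \<in> sets M"
    and "AE \<omega> in M. P \<omega> \<longrightarrow> P' \<omega>"
  shows "AE \<omega> in M. sigma_prob M G P \<omega> \<le> sigma_prob M G P' \<omega>"
proof -
  interpret sigma_finite_subalgebra M G
    by (rule sigma_finite_subalgebraI[OF sub])
  show ?thesis
    unfolding sigma_prob_def using assms
    by (intro real_cond_exp_mono) (auto simp: emeasure_eq_measure indicator_def)
qed

lemma (in prob_space) sigma_prob_nonneg:
  assumes sub: "subalgebra M G" and "{\<omega>\<in>space M. P \<omega>} \<in> sets M"
  shows "AE \<omega> in M. 0 \<le> sigma_prob M G P \<omega>"
proof -
  interpret sigma_finite_subalgebra M G
    by (rule sigma_finite_subalgebraI[OF sub])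
  show ?thesis
    unfolding sigma_prob_def using assms
    by (intro real_cond_exp_pos) auto
qed

text \<open>Condition first on the larger \<open>I\<close>, in which \<open>P\<close> is known and
  \<open>F\<close> can still be frozen, then on \<open>G\<close>, where the section measure is known
  and factors out. Dividing by the conditional probability of \<open>P\<close>, where it is nonzero,
  thus leaves the section measure alone.\<close>

lemma (in prob_space) sigma_prob_freeze_conj:
  assumes GI: "subalgebra I G" and I: "subalgebra M I" and F[measurable]: "F \<in> measurable M T"
    and ind: "indep_set (sets (vimage_algebra (space M) F T)) (sets I)"
    and Q: "Q \<in> sets (G \<Otimes>\<^sub>M T)"
    and P: "{\<omega>\<in>space M. P \<omega>} \<in> sets I"
  shows "AE \<omega> in M. sigma_prob M G (\<lambda>\<omega>. (\<omega>, F \<omega>) \<in> Q \<and> P \<omega>) \<omega> =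
           measure (distr M T F) (Pair \<omega> -` Q) * sigma_prob M G P \<omega>"
proof -
  have G: "subalgebra M G"
    using GI I by (auto simp: subalgebra_def)
  interpret sigma_finite_subalgebra M G
    by (rule sigma_finite_subalgebraI[OF G])
  interpret I: sigma_finite_subalgebra M I
    by (rule sigma_finite_subalgebraI[OF I])
  interpret \<mu>: prob_space "distr M T F"
    by (rule prob_space_distr) measurable
  have sp: "space I = space M"
    using I by (simp add: subalgebra_def)
  define A where "A = {\<omega>\<in>space M. P \<omega>}"
  define g where "g \<omega> = measure (distr M T F) (Pair \<omega> -` Q)" for \<omega>
  have AI[measurable]: "A \<in> sets I" and AM[measurable]: "A \<in> sets M"
    using P I by (auto simp: A_def subalgebra_def)
  have g[measurable]: "g \<in> borel_measurable G"
  proof -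
    have "Q \<in> sets (G \<Otimes>\<^sub>M distr M T F)"
      using Q by (simp cong: sets_pair_measure_cong)
    from \<mu>.measurable_emeasure_Pair[OF this] show ?thesis
      unfolding g_def measure_def by measurable
  qed
  have gM[measurable]: "g \<in> borel_measurable M"
    using measurable_from_subalg[OF G g] .
  \<comment> \<open>Lifting \<open>Q\<close> to the finer \<open>I\<close> along the identity map
    allows freezing with respect to \<open>I\<close>.\<close>
  have QI: "Q \<in> sets (I \<Otimes>\<^sub>M T)"
  proof -
    have "(\<lambda>p. p) \<in> measurable (I \<Otimes>\<^sub>M T) (G \<Otimes>\<^sub>M T)"
      using measurable_from_subalg[OF GI measurable_ident_sets[OF refl, of G]]
      by (intro measurable_pair) (auto simp: comp_def intro: measurable_compose[OF measurable_fst])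
    from measurable_sets[OF this Q] show ?thesis
      using sets.sets_into_space[OF Q] GI
      by (simp add: Int_absorb2 space_pair_measure subalgebra_def)
  qed
  then have Q'[measurable]: "Q \<inter> (A \<times> space T) \<in> sets (I \<Otimes>\<^sub>M T)"
    by measurable
  have id[measurable]: "(\<lambda>\<omega>. \<omega>) \<in> measurable M I"
    using measurable_from_subalg[OF I measurable_ident_sets[OF refl, of I]] by simp
  \<comment> \<open>Writing \<open>P\<close> as the cylinder \<open>A \<times> space T\<close> makes
    the conjunction a single product-measurable event.\<close>
  define f :: "'a \<Rightarrow> real" where "f = indicator {\<omega>\<in>space M. (\<omega>, F \<omega>) \<in> Q \<inter> (A \<times> space T)}"
  have f: "integrable M f"
  proof -
    have "{\<omega>\<in>space M. (\<omega>, F \<omega>) \<in> Q \<inter> (A \<times> space T)} \<in> sets M"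
      by measurable
    then show ?thesis
      unfolding f_def by (rule integrable_real_indicator) (simp add: emeasure_eq_measure)
  qed
  have int: "integrable M (\<lambda>\<omega>. g \<omega> * indicator A \<omega>)"
  proof (rule integrable_const_bound[where B=1])
    show "AE \<omega> in M. norm (g \<omega> * indicator A \<omega>) \<le> 1"
      by (auto simp: g_def \<mu>.prob_le_1 indicator_def)
  qed measurable
  have "AE \<omega> in M. real_cond_exp M I f \<omega> = g \<omega> * indicator A \<omega>"
    using sigma_prob_freeze[OF I F ind Q']
  proof eventually_elim
    case (elim \<omega>)
    have "Pair \<omega> -` (Q \<inter> A \<times> space T) = (if \<omega> \<in> A then Pair \<omega> -` Q else {})"
      using sets.sets_into_space[OF Q] by (auto simp: space_pair_measure)
    with elim show ?case
      by (auto simp: sigma_prob_def f_def g_def)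
  qed
  then have "AE \<omega> in M. real_cond_exp M G (real_cond_exp M I f) \<omega> =
      real_cond_exp M G (\<lambda>\<omega>. g \<omega> * indicator A \<omega>) \<omega>"
    by (rule real_cond_exp_cong) (measurable)
  moreover have "AE \<omega> in M. real_cond_exp M G (real_cond_exp M I f) \<omega> = real_cond_exp M G f \<omega>"
    by (rule real_cond_exp_nested_subalg[OF I GI f])
  moreover have "AE \<omega> in M. real_cond_exp M G (\<lambda>\<omega>. g \<omega> * indicator A \<omega>) \<omega> =
      g \<omega> * real_cond_exp M G (indicator A) \<omega>"
    by (rule real_cond_exp_mult) (use int in measurable)
  moreover have "f = indicator {\<omega>\<in>space M. (\<omega>, F \<omega>) \<in> Q \<and> P \<omega>}"
    unfolding f_def A_def using measurable_space[OF F] by (intro arg_cong[where f=indicator]) auto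
  ultimately show ?thesis
    unfolding sigma_prob_def g_def A_def by (auto elim: eventually_mono)
qed

section \<open>Tube violation bounds conditional infeasibility\<close>

lemma sigma_prob_cong:
  assumes "\<And>\<omega>. \<omega> \<in> space M \<Longrightarrow> P \<omega> \<longleftrightarrow> P' \<omega>"
  shows "sigma_prob M G P = sigma_prob M G P'"
proof -
  have "{\<omega>\<in>space M. P \<omega>} = {\<omega>\<in>space M. P' \<omega>}"
    using assms by auto
  then show ?thesis by (simp add: sigma_prob_def)
qed

text \<open>\<open>calib_data\<close> restricts the family to \<open>{1..N}\<close>, and
  restrictions of an independent family to disjoint index sets are independent. This is what lets
  the fresh trajectory be frozen against the calibration data.\<close>

lemma (in prob_space) indep_set_fresh_calib_sigma:
  fixes R :: "nat \<Rightarrow> 'a \<Rightarrow> nat \<Rightarrow> real^'n"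
  assumes "indep_vars (\<lambda>_. traj_space H) R {1..N+1}"
  shows "indep_set (sets (vimage_algebra (space M) (R (N + 1)) (traj_space H)))
           (sets (calib_sigma M N H R))"
proof -
  let ?T = "traj_space H :: (nat \<Rightarrow> real^'n) measure"
  have R: "R (N + 1) \<in> measurable M ?T"
    using assms by (auto simp: indep_vars_def)
  have iv: "indep_var (PiM {N+1} (\<lambda>_. ?T)) (\<lambda>\<omega>. restrict (\<lambda>i. R i \<omega>) {N+1})
      (PiM {1..N} (\<lambda>_. ?T)) (\<lambda>\<omega>. restrict (\<lambda>i. R i \<omega>) {1..N})"
    by (rule indep_var_restrict[OF assms]) auto
  \<comment> \<open>Block independence speaks of functions on a one-point index set;
    \<open>R (N + 1)\<close> is the only component of such a function and so generates no further
    events.\<close>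
  have "sets (vimage_algebra (space M) (R (N + 1)) ?T) \<subseteq>
      sets (vimage_algebra (space M) (\<lambda>\<omega>. restrict (\<lambda>i. R i \<omega>) {N+1}) (PiM {N+1} (\<lambda>_. ?T)))"
      (is "_ \<subseteq> sets ?V")
  proof (rule sets_image_in_sets)
    have "(\<lambda>\<omega>. restrict (\<lambda>i. R i \<omega>) {N+1}) \<in> measurable ?V (PiM {N+1} (\<lambda>_. ?T))"
      using R[THEN measurable_space] by (intro measurable_vimage_algebra1) (auto simp: space_PiM)
    from measurable_compose[OF this measurable_component_singleton[of "N+1"]]
    show "R (N + 1) \<in> measurable ?V ?T" by simp
  qed simp
  with iv show ?thesis
    unfolding indep_var_eq indep_sets2_eq calib_data_def[abs_def] sets_vimage_algebra
    by (meson subset_eq)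
qed

text \<open>Both sides are governed by the same section measure: \<open>R (N + 1)\<close> is frozen
  against the calibration data, \<open>F\<close> against the online information, and the two have
  the same law. In the application \<open>P\<close> is feasibility at \<open>k\<close> and
  \<open>P'\<close> is infeasibility at \<open>k + 1\<close>.\<close>

lemma sigma_cond_prob_le_tube_violation:
  fixes R :: "nat \<Rightarrow> 'w \<Rightarrow> nat \<Rightarrow> real^'n" and E :: "'t \<Rightarrow> (nat \<Rightarrow> real^'n) set"
  assumes samp: "fresh_sampling M N H R I F"
    and th: "thhat \<in> measurable (sample_space N H) \<Theta>"
    and graph: "{(\<theta>, e). \<theta> \<in> space \<Theta> \<and> e \<in> E \<theta>} \<in> sets (\<Theta> \<Otimes>\<^sub>M traj_space H)"
    and P_I: "{\<omega>\<in>space M. P \<omega>} \<in> sets I"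
    and P'_M: "{\<omega>\<in>space M. P' \<omega>} \<in> sets M"
    and exits: "AE \<omega> in M. P' \<omega> \<and> P \<omega> \<longrightarrow> F \<omega> \<notin> E (thhat (calib_data N R \<omega>))"
  shows "AE \<omega> in M. sigma_cond_prob M (calib_sigma M N H R) P' P \<omega> \<le>
           tube_violation M N H R E thhat \<omega>"
proof -
  interpret prob_space M
    using samp unfolding fresh_sampling_def by blast
  define G where "G = calib_sigma M N H R"
  define T where "T = (traj_space H :: (nat \<Rightarrow> real^'n) measure)"
  define \<theta>N where "\<theta>N = (\<lambda>\<omega>. thhat (calib_data N R \<omega>))"
  have indR: "indep_vars (\<lambda>_. T) R {1..N+1}"
    and I: "subalgebra M I"
    and calib_I: "calib_data N R \<in> measurable I (sample_space N H)"
    and F: "F \<in> measurable M T"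
    and indF: "indep_set (sets (vimage_algebra (space M) F T)) (sets I)"
    using samp unfolding fresh_sampling_def T_def by blast+
  have law: "distr M T F = distr M T (R (N + 1))"
  proof -
    have "N + 1 \<in> {1..N+1}" by simp
    then show ?thesis
      using samp unfolding fresh_sampling_def T_def by metis
  qed
  have RF: "R (N + 1) \<in> measurable M T"
    using indR by (auto simp: indep_vars_def)
  have sp: "space I = space M"
    using I by (simp add: subalgebra_def)
  \<comment> \<open>The calibration data are part of the online information; the tower argument
    rests on this inclusion.\<close>
  have GI: "subalgebra I G"
    unfolding subalgebra_def G_def using sets_image_in_sets[OF sp calib_I] by (simp add: sp)
  then have G: "subalgebra M G"
    using I by (auto simp: subalgebra_def)
  have calib_G: "calib_data N R \<in> measurable G (sample_space N H)"
    unfolding G_def using measurable_space[OF calib_I]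
    by (intro measurable_vimage_algebra1) (simp add: sp)
  have \<theta>N[measurable]: "\<theta>N \<in> measurable G \<Theta>"
    unfolding \<theta>N_def by (rule measurable_compose[OF calib_G th])
  have \<theta>N_space: "\<theta>N \<omega> \<in> space \<Theta>" if "\<omega> \<in> space M" for \<omega>
    using measurable_space[OF \<theta>N] that by (simp add: G_def)
  \<comment> \<open>Exit from the tube as a set of pairs, in which the sample point acts only
    through the calibrated parameter. Its measurability is that of the tube graph, pulled back along
    that parameter.\<close>
  define Q where "Q = {(\<omega>, e). \<omega> \<in> space M \<and> e \<in> space T \<and> e \<notin> E (\<theta>N \<omega>)}"
  have Q: "Q \<in> sets (G \<Otimes>\<^sub>M T)"
  proof -
    let ?f = "\<lambda>p. (\<theta>N (fst p), snd p)"
    let ?C = "space (\<Theta> \<Otimes>\<^sub>M T) - {(\<theta>, e). \<theta> \<in> space \<Theta> \<and> e \<in> E \<theta>}"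
    have "?f \<in> measurable (G \<Otimes>\<^sub>M T) (\<Theta> \<Otimes>\<^sub>M T)"
      by measurable
    moreover have "?C \<in> sets (\<Theta> \<Otimes>\<^sub>M T)"
      using graph unfolding T_def by (rule sets.compl_sets)
    ultimately have "?f -` ?C \<inter> space (G \<Otimes>\<^sub>M T) \<in> sets (G \<Otimes>\<^sub>M T)"
      by (rule measurable_sets)
    also have "?f -` ?C \<inter> space (G \<Otimes>\<^sub>M T) = Q"
      using \<theta>N_space by (auto simp: Q_def G_def space_pair_measure)
    finally show ?thesis .
  qed
  have in_Q: "(\<omega>, e) \<in> Q \<longleftrightarrow> e \<notin> E (\<theta>N \<omega>)" if "\<omega> \<in> space M" "e \<in> space T" for \<omega> e
    using that by (simp add: Q_def)
  have P_M: "{\<omega>\<in>space M. P \<omega>} \<in> sets M"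
    using P_I I by (auto simp: subalgebra_def)
  have "(\<lambda>\<omega>. \<omega>) \<in> measurable M G"
    using measurable_from_subalg[OF G measurable_ident_sets[OF refl, of G]] by simp
  then have "(\<lambda>\<omega>. (\<omega>, F \<omega>)) \<in> measurable M (G \<Otimes>\<^sub>M T)"
    using F by (rule measurable_Pair)
  from measurable_sets[OF this Q] have "{\<omega>\<in>space M. (\<omega>, F \<omega>) \<in> Q} \<in> sets M"
    by (simp add: vimage_def Int_def conj_commute)
  note Q_P = sets.sets_Collect_conj[OF P_M this]
  note P'_P = sets.sets_Collect_conj[OF P_M P'_M]
  have "AE \<omega> in M. P' \<omega> \<and> P \<omega> \<longrightarrow> (\<omega>, F \<omega>) \<in> Q \<and> P \<omega>"
    using exits AE_space
    by eventually_elim (use measurable_space[OF F] in \<open>auto simp: in_Q \<theta>N_def\<close>)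
  note mono = sigma_prob_mono[OF G P'_P Q_P this]
  have viol: "tube_violation M N H R E thhat = sigma_prob M G (\<lambda>\<omega>. (\<omega>, R (N + 1) \<omega>) \<in> Q)"
    unfolding tube_violation_def G_def[symmetric]
    by (rule sigma_prob_cong) (use measurable_space[OF RF] in \<open>simp add: in_Q \<theta>N_def\<close>)
  have indRG: "indep_set (sets (vimage_algebra (space M) (R (N + 1)) T)) (sets G)"
    unfolding G_def T_def by (rule indep_set_fresh_calib_sigma[OF indR[unfolded T_def]])
  have "AE \<omega> in M. sigma_cond_prob M G P' P \<omega> \<le> tube_violation M N H R E thhat \<omega>"
    using sigma_prob_freeze[OF G RF indRG Q] sigma_prob_freeze_conj[OF GI I F indF Q P_I]
      mono sigma_prob_nonneg[OF G P_M]
  proof eventually_elim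
    case (elim \<omega>)
    \<comment> \<open>Where \<open>P\<close> has conditional probability zero, the quotient is
      \<open>0\<close> by the convention for division, and the violation probability is
      nonnegative.\<close>
    then show ?case
      by (cases "sigma_prob M G P \<omega> = 0")
        (simp_all add: sigma_cond_prob_def viol law divide_le_eq)
  qed
  then show ?thesis by (simp add: G_def)
qed

theorem theorem11:
  fixes A :: "real^'n^'n" and B :: "real^'m^'n" and K :: "real^'n^'m"
    and X :: "(real^'n) set" and U :: "(real^'m) set" and H :: nat
    and l :: "real^'n \<Rightarrow> real^'m \<Rightarrow> real" and lf :: "real^'n \<Rightarrow> real"
    and \<Theta> :: "'t measure"
    and E :: "'t \<Rightarrow> (nat \<Rightarrow> real^'n) set"
    and S :: "'t \<Rightarrow> nat \<Rightarrow> (real^'n) set" and Xf :: "'t \<Rightarrow> (real^'n) set"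
    and M I :: "'w measure"
    and N s k :: nat and \<beta> :: real
    and R :: "nat \<Rightarrow> 'w \<Rightarrow> nat \<Rightarrow> real^'n"
    and thhat :: "(nat \<Rightarrow> nat \<Rightarrow> real^'n) \<Rightarrow> 't"
    and x w :: "nat \<Rightarrow> 'w \<Rightarrow> real^'n" and u :: "nat \<Rightarrow> 'w \<Rightarrow> real^'m"
    and zs :: "nat \<Rightarrow> 'w \<Rightarrow> nat \<Rightarrow> real^'n" and vs :: "nat \<Rightarrow> 'w \<Rightarrow> nat \<Rightarrow> real^'m"
  assumes "H \<ge> 1"
    and "compact X" "convex X" "0 \<in> interior X"
    and "compact U" "convex U" "0 \<in> interior U"
    and "schur_stable (A + B ** K)"
    and "\<forall>\<theta>\<in>space \<Theta>. E \<theta> \<in> sets (traj_space H)"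
    and "\<forall>\<theta>\<in>space \<Theta>. cross_sections H (E \<theta>) (S \<theta>)"
  shows
    "(\<forall>\<theta>\<in>space \<Theta>.
        shift_compatible (A + B ** K) H (S \<theta>) \<and>
        terminal_ingredients A B K X U H l lf (S \<theta>) (Xf \<theta>) \<longrightarrow>
        (\<forall>xk uk wk xk' z v.
           ctmpc_optimal A B K X U H l lf (S \<theta>) (Xf \<theta>) xk z v \<and>
           uk = v 0 \<and>
           xk' = A *v xk + B *v uk + wk \<and>
           xk' - z 1 \<in> S \<theta> 1 \<longrightarrow>
           ctmpc_feasible A B K X U H (S \<theta>) (Xf \<theta>) xk'))
     \<and>
     (let \<theta>N = (\<lambda>\<omega>. thhat (calib_data N R \<omega>));
          feas = (\<lambda>j \<omega>. ctmpc_feasible A B K X U H (S (\<theta>N \<omega>)) (Xf (\<theta>N \<omega>)) (x j \<omega>));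
          Ek = (\<lambda>\<omega>. error_traj (A + B ** K) H (\<lambda>t. w (k + t) \<omega>))
      in
        0 < \<beta> \<and> \<beta> < 1 \<and> s \<in> {1..N} \<and>
        fresh_sampling M N H R I Ek \<and>
        thhat \<in> measurable (sample_space N H) \<Theta> \<and>
        {(\<theta>, e). \<theta> \<in> space \<Theta> \<and> e \<in> E \<theta>} \<in> sets (\<Theta> \<Otimes>\<^sub>M traj_space H) \<and>
        x k \<in> borel_measurable I \<and>
        {\<omega>\<in>space M. feas k \<omega>} \<in> sets I \<and>
        {\<omega>\<in>space M. \<not> feas (Suc k) \<omega>} \<in> sets M \<and>
        (AE \<omega> in M. shift_compatible (A + B ** K) H (S (\<theta>N \<omega>)) \<and>
                     terminal_ingredients A B K X U H l lf (S (\<theta>N \<omega>)) (Xf (\<theta>N \<omega>))) \<and>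
        (\<forall>\<omega>\<in>space M. x (Suc k) \<omega> = A *v x k \<omega> + B *v u k \<omega> + w k \<omega>) \<and>
        (\<forall>\<omega>\<in>space M. feas k \<omega> \<longrightarrow>
           ctmpc_optimal A B K X U H l lf (S (\<theta>N \<omega>)) (Xf (\<theta>N \<omega>)) (x k \<omega>) (zs k \<omega>) (vs k \<omega>) \<and>
           u k \<omega> = vs k \<omega> 0) \<and>
        measure M {\<omega>\<in>space M. tube_violation M N H R E thhat \<omega> \<le> risk_level N s \<beta>} \<ge> 1 - \<beta>
        \<longrightarrow>
        measure M {\<omega>\<in>space M.
          sigma_cond_prob M (calib_sigma M N H R) (\<lambda>\<omega>. \<not> feas (Suc k) \<omega>) (feas k) \<omega>
            \<le> risk_level N s \<beta>} \<ge> 1 - \<beta>)"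
proof (rule conjI, goal_cases)
  case 1
  show ?case
    using ctmpc_feasible_shift[OF \<open>H \<ge> 1\<close>] unfolding ctmpc_optimal_def by blast
next
  case 2
  let ?\<theta> = "\<lambda>\<omega>. thhat (calib_data N R \<omega>)"
  let ?feas = "\<lambda>j \<omega>. ctmpc_feasible A B K X U H (S (?\<theta> \<omega>)) (Xf (?\<theta> \<omega>)) (x j \<omega>)"
  let ?F = "\<lambda>\<omega>. error_traj (A + B ** K) H (\<lambda>t. w (k + t) \<omega>)"
  let ?G = "calib_sigma M N H R"
  let ?p = "sigma_cond_prob M ?G (\<lambda>\<omega>. \<not> ?feas (Suc k) \<omega>) (?feas k)"
  show ?case
    unfolding Let_def
  proof (intro impI, elim conjE)
    assume samp: "fresh_sampling M N H R I ?F"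
      and th: "thhat \<in> measurable (sample_space N H) \<Theta>"
      and graph: "{(\<theta>, e). \<theta> \<in> space \<Theta> \<and> e \<in> E \<theta>} \<in> sets (\<Theta> \<Otimes>\<^sub>M traj_space H)"
      and feas_I: "{\<omega>\<in>space M. ?feas k \<omega>} \<in> sets I"
      and infeas_M: "{\<omega>\<in>space M. \<not> ?feas (Suc k) \<omega>} \<in> sets M"
      and ingr: "AE \<omega> in M. shift_compatible (A + B ** K) H (S (?\<theta> \<omega>)) \<and>
            terminal_ingredients A B K X U H l lf (S (?\<theta> \<omega>)) (Xf (?\<theta> \<omega>))"
      and dyn: "\<forall>\<omega>\<in>space M. x (Suc k) \<omega> = A *v x k \<omega> + B *v u k \<omega> + w k \<omega>"
      and opt: "\<forall>\<omega>\<in>space M. ?feas k \<omega> \<longrightarrow>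
            ctmpc_optimal A B K X U H l lf (S (?\<theta> \<omega>)) (Xf (?\<theta> \<omega>)) (x k \<omega>) (zs k \<omega>) (vs k \<omega>) \<and>
            u k \<omega> = vs k \<omega> 0"
      and conf: "1 - \<beta> \<le> measure M {\<omega>\<in>space M. tube_violation M N H R E thhat \<omega> \<le> risk_level N s \<beta>}"
    interpret prob_space M
      using samp unfolding fresh_sampling_def by blast
    have I: "subalgebra M I" and calib_I: "calib_data N R \<in> measurable I (sample_space N H)"
      using samp unfolding fresh_sampling_def by blast+
    have \<theta>_space: "?\<theta> \<omega> \<in> space \<Theta>" if "\<omega> \<in> space M" for \<omega>
      using measurable_space[OF measurable_compose[OF calib_I th]] that I
      by (simp add: subalgebra_def)
    \<comment> \<open>Recursive feasibility in contrapositive form along a sample path; only the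
      first block of the online trajectory enters.\<close>
    have "AE \<omega> in M. \<not> ?feas (Suc k) \<omega> \<and> ?feas k \<omega> \<longrightarrow> ?F \<omega> \<notin> E (?\<theta> \<omega>)"
      using ingr AE_space
    proof eventually_elim
      case (elim \<omega>)
      show ?case
      proof (intro impI notI)
        assume f: "\<not> ?feas (Suc k) \<omega> \<and> ?feas k \<omega>" and "?F \<omega> \<in> E (?\<theta> \<omega>)"
        moreover have "cross_sections H (E (?\<theta> \<omega>)) (S (?\<theta> \<omega>))"
          using assms(10) \<theta>_space[OF elim(2)] by blast
        ultimately have "?F \<omega> 1 \<in> S (?\<theta> \<omega>) 1"
          using \<open>H \<ge> 1\<close> unfolding cross_sections_def by (simp add: image_subset_iff)
        \<comment> \<open>The prediction error starts from \<open>0\<close>, so its first value is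
          the disturbance \<open>w k\<close> itself.\<close>
        then have wS: "w k \<omega> \<in> S (?\<theta> \<omega>) 1"
          using \<open>H \<ge> 1\<close> by (simp add: error_traj_def)
        have adm: "ctmpc_admissible A B K X U H (S (?\<theta> \<omega>)) (Xf (?\<theta> \<omega>)) (x k \<omega>) (zs k \<omega>) (vs k \<omega>)"
          and u: "u k \<omega> = vs k \<omega> 0"
          using opt f elim(2) unfolding ctmpc_optimal_def by blast+
        \<comment> \<open>The plan starts at the measured state and its first input is applied, so
          the planned successor is the disturbance-free one and the deviation from it is
          \<open>w k\<close>.\<close>
        have "zs k \<omega> 1 = A *v x k \<omega> + B *v u k \<omega>"
          using adm u \<open>H \<ge> 1\<close> by (simp add: ctmpc_admissible_def)
        with dyn elim(2) wS have "x (Suc k) \<omega> - zs k \<omega> 1 \<in> S (?\<theta> \<omega>) 1"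
          by simp
        then have "?feas (Suc k) \<omega>"
          using elim(1) by (intro ctmpc_feasible_shift[OF \<open>H \<ge> 1\<close> _ _ adm]) blast+
        with f show False by blast
      qed
    qed
    from sigma_cond_prob_le_tube_violation[where E=E, OF samp th graph feas_I infeas_M this]
    have "AE \<omega> in M. ?p \<omega> \<le> tube_violation M N H R E thhat \<omega>" .
    \<comment> \<open>\<open>measure\<close> is \<open>0\<close> on nonmeasurable sets, so comparing
      the two probabilities requires the larger event to be measurable.\<close>
    moreover have "?p \<in> borel_measurable M"
      unfolding sigma_cond_prob_def[abs_def] sigma_prob_def
      by (intro borel_measurable_divide borel_measurable_cond_exp2)
    \<comment> \<open>Up to a null set, the confidence event for the tube violation is contained in
      the event of the claim.\<close>
    ultimately have "measure M {\<omega>\<in>space M. tube_violation M N H R E thhat \<omega> \<le> risk_level N s \<beta>} \<le>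
        measure M {\<omega>\<in>space M. ?p \<omega> \<le> risk_level N s \<beta>}"
      by (intro finite_measure_mono_AE) (auto elim: eventually_mono)
    with conf show "1 - \<beta> \<le> measure M {\<omega>\<in>space M. ?p \<omega> \<le> risk_level N s \<beta>}"
      by linarith
  qed
qed

end
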